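(* Let $k,h,n_1,\dots,n_k$ be positive integers such that for every $1\le i\le k$, $n_i$ divides $\gcd(h,n_i)^2$ and $(\nu_2(n_i),\nu_2(h))\neq(1,1)$. Then a perfect $h$-phase array of size $n_1\times\cdots\times n_k$ exists.
   Context: $\nu_2(x)$ is the $2$-adic valuation of $x$. A perfect $h$-phase array of size $n_1\times\cdots\times n_k$ is an array $A=(a_{i_1,\dots,i_k})_{0\le i_j\le n_j-1}$ of complex $h$th roots of unity such that $\sum_{0\le i_j\le n_j-1\ \forall j} a_{i_1,\dots,i_k}\overline{a_{i_1+s_1,\dots,i_k+s_k}}=0$ for every $(s_1,\dots,s_k)\neq(0,\dots,0)$, indices taken modulo $n_j$. *)

theory Defs
  imports Complex_Main "HOL-Library.FuncSet" "HOL-Computational_Algebra.Primes"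
begin

definition array_index :: "nat \<Rightarrow> (nat \<Rightarrow> nat) \<Rightarrow> (nat \<Rightarrow> nat) set" where
  "array_index k n = (\<Pi>\<^sub>E j\<in>{1..k}. {..<n j})"

definition shift_index :: "nat \<Rightarrow> (nat \<Rightarrow> nat) \<Rightarrow> (nat \<Rightarrow> nat) \<Rightarrow> (nat \<Rightarrow> nat) \<Rightarrow> (nat \<Rightarrow> nat)" where
  "shift_index k n i s = (\<lambda>j\<in>{1..k}. (i j + s j) mod n j)"

text \<open>Only the values of an array at the multi-indices in \<^term>\<open>array_index k n\<close> are relevant.
  Since indices are read modulo \<open>n j\<close>, the shifts also range over \<^term>\<open>array_index k n\<close>.\<close>

definition perfect_phase_array ::
    "nat \<Rightarrow> nat \<Rightarrow> (nat \<Rightarrow> nat) \<Rightarrow> ((nat \<Rightarrow> nat) \<Rightarrow> complex) \<Rightarrow> bool" where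
  "perfect_phase_array h k n A \<longleftrightarrow>
     (\<forall>i\<in>array_index k n. A i ^ h = 1) \<and>
     (\<forall>s\<in>array_index k n. (\<exists>j\<in>{1..k}. s j \<noteq> 0) \<longrightarrow>
        (\<Sum>i\<in>array_index k n. A i * cnj (A (shift_index k n i s))) = 0)"

end

theory Submission
  imports Defs
begin

text \<open>
  A product of one-dimensional perfect sequences is a perfect array, so one sequence of each
  length \<open>n\<close> suffices. Write \<open>n = s m\<^sup>2\<close> and let \<open>a (l m + k) = \<omega> ^ (c m l\<^sup>2 + k l)\<close> for \<open>k < m\<close>,
  where \<open>\<omega>\<close> is a primitive root of unity of order \<open>s m\<close> and \<open>c\<close> is \<open>1/2\<close> or \<open>1\<close> according to whether
  \<open>s\<close> is even or odd (Mow's construction). In the autocorrelation at a shift not divisible by \<open>m\<close>,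
  the sum over \<open>l\<close> already vanishes for each \<open>k\<close>. At a shift \<open>m t\<close> the sum over \<open>l\<close> vanishes unless
  \<open>s\<close> divides \<open>t\<close>, and then the sum over \<open>k\<close> vanishes. With \<open>g = gcd h n\<close>, the choice \<open>m = n / g\<close>,
  \<open>s = g\<^sup>2 / n\<close> gives \<open>s m = g\<close>, a divisor of \<open>h\<close>, and \<open>c m\<close> is an integer
  unless \<open>s\<close> is even and \<open>m\<close> is odd. In that case either \<open>4\<close> divides \<open>s\<close>, and \<open>(s / 4, 2 m)\<close> replaces \<open>(s, m)\<close>,
  or the condition at \<open>2\<close> forces \<open>2 s m\<close> to divide \<open>h\<close>.
\<close>

section \<open>Roots of unity and geometric sums\<close>

definition unit_root :: "nat \<Rightarrow> int \<Rightarrow> complex" where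
  "unit_root N x = cis (2 * pi * real_of_int x / real N)"

lemma unit_root_0 [simp]: "unit_root N 0 = 1"
  by (simp add: unit_root_def)

lemma unit_root_add: "unit_root N (x + y) = unit_root N x * unit_root N y"
  by (simp add: unit_root_def cis_mult add_divide_distrib distrib_left)

lemma cnj_unit_root: "cnj (unit_root N x) = unit_root N (- x)"
  by (simp add: unit_root_def cis_cnj)

lemma unit_root_power: "unit_root N x ^ j = unit_root N (x * int j)"
  by (simp add: unit_root_def DeMoivre mult_ac)

lemma unit_root_eq_1_iff:
  assumes "N > 0"
  shows "unit_root N x = 1 \<longleftrightarrow> int N dvd x"
proof
  assume "unit_root N x = 1"
  then have "cos (2 * pi * real_of_int x / real N) = 1"
    by (simp add: unit_root_def complex_eq_iff)
  then obtain i :: int where "2 * pi * real_of_int x / real N = of_int i * (2 * pi)"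
    by (auto simp: cos_one_2pi_int)
  then have "real_of_int x = real_of_int (i * int N)"
    using assms by (simp add: field_simps)
  then have "x = i * int N"
    by (simp only: of_int_eq_iff)
  then show "int N dvd x"
    by simp
next
  assume "int N dvd x"
  then obtain i where "x = int N * i" ..
  then show "unit_root N x = 1"
    using assms cis_multiple_2pi[of "of_int i"] by (simp add: unit_root_def mult.assoc)
qed

lemma unit_root_cong:
  assumes "N > 0" "int N dvd x - y"
  shows "unit_root N x = unit_root N y"
  using unit_root_add[of N "x - y" y] assms by (simp add: unit_root_eq_1_iff)

lemma sum_unit_root_eq_0:
  assumes "N > 0" "int N dvd x * int M" "\<not> int N dvd x"
  shows "(\<Sum>j<M. unit_root N (x * int j)) = 0"
proof -
  have "unit_root N x \<noteq> 1" "unit_root N x ^ M = 1"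
    using assms by (simp_all add: unit_root_power unit_root_eq_1_iff)
  then have "(\<Sum>j<M. unit_root N x ^ j) = 0"
    by (simp add: geometric_sum)
  then show ?thesis
    by (simp add: unit_root_power)
qed

section \<open>Mow's perfect sequences\<close>

text \<open>
  The parameter \<open>d\<close> is \<open>2 c\<close>, and exponents are doubled accordingly so as to be integers.
\<close>

definition mow_exponent :: "nat \<Rightarrow> nat \<Rightarrow> nat \<Rightarrow> nat" where
  "mow_exponent m d i = m * d * (i div m)\<^sup>2 + 2 * (i mod m) * (i div m)"

definition mow_sequence :: "nat \<Rightarrow> nat \<Rightarrow> nat \<Rightarrow> nat \<Rightarrow> complex" where
  "mow_sequence s m d i = unit_root (2 * s * m) (int (mow_exponent m d i))"

definition perfect_sequence :: "nat \<Rightarrow> nat \<Rightarrow> (nat \<Rightarrow> complex) \<Rightarrow> bool" where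
  "perfect_sequence h n a \<longleftrightarrow>
     (\<forall>i. a i ^ h = 1) \<and>
     (\<forall>t. 0 < t \<and> t < n \<longrightarrow> (\<Sum>i<n. a i * cnj (a ((i + t) mod n))) = 0)"

text \<open>Moving \<open>l\<close> to \<open>l + s * m\<close> adds
  \<open>m * d * (s * m)\<^sup>2\<close> and evident multiples of \<open>2 * s * m\<close> to the
  exponent; as \<open>d * s\<close> is even, the former is such a multiple too.\<close>

lemma mow_sequence_periodic:
  assumes "s > 0" "m > 0" "even (d * s)"
  shows "mow_sequence s m d (i + s * m\<^sup>2) = mow_sequence s m d i"
proof -
  define l where "l = i div m"
  have "(i + s * m\<^sup>2) div m = l + s * m"
    using assms by (simp add: l_def power2_eq_square flip: mult.assoc)
  moreover have "(i + s * m\<^sup>2) mod m = i mod m"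
    by (simp add: power2_eq_square flip: mult.assoc)
  moreover obtain q where "d * s = 2 * q"
    using assms(3) by blast
  then have "m * d * (l + s * m)\<^sup>2 = m * d * l\<^sup>2 + 2 * s * m * (m * d * l + m\<^sup>2 * q)"
    by algebra
  ultimately have "mow_exponent m d (i + s * m\<^sup>2)
      = mow_exponent m d i + (2 * s * m) * (m * d * l + m\<^sup>2 * q + i mod m)"
    by (simp add: mow_exponent_def algebra_simps flip: l_def)
  then have "int (mow_exponent m d (i + s * m\<^sup>2)) - int (mow_exponent m d i)
      = int (2 * s * m) * int (m * d * l + m\<^sup>2 * q + i mod m)"
    by (simp only: of_nat_add of_nat_mult)
  then show ?thesis
    using assms unfolding mow_sequence_def by (intro unit_root_cong) auto
qed

text \<open>This lets the cyclic autocorrelation be computed with the unreduced index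
  \<open>i + t\<close>.\<close>

lemma mow_sequence_mod:
  assumes "s > 0" "m > 0" "even (d * s)"
  shows "mow_sequence s m d (i mod (s * m\<^sup>2)) = mow_sequence s m d i"
proof -
  have "mow_sequence s m d (j + q * (s * m\<^sup>2)) = mow_sequence s m d j" for j q
  proof (induction q)
    case (Suc q)
    then show ?case
      using mow_sequence_periodic[OF assms, of "j + q * (s * m\<^sup>2)"] by (simp add: add_ac)
  qed simp
  from this[of "i mod (s * m\<^sup>2)" "i div (s * m\<^sup>2)"] show ?thesis
    by (simp only: mod_div_mult_eq)
qed

lemma sum_lessThan_mult_nat:
  fixes f :: "nat \<Rightarrow> 'a::comm_monoid_add"
  shows "(\<Sum>i<a * b. f i) = (\<Sum>k<b. \<Sum>l<a. f (l * b + k))"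
proof -
  have "(\<Sum>i<a * b. f i) = (\<Sum>l<a. sum f {l * b..<l * b + b})"
    by (rule sum.nat_group[symmetric])
  also have "\<dots> = (\<Sum>l<a. \<Sum>k<b. f (l * b + k))"
  proof (rule sum.cong)
    fix l
    show "sum f {l * b..<l * b + b} = (\<Sum>k<b. f (l * b + k))"
      using sum.shift_bounds_nat_ivl[of f 0 "l * b" b]
      by (simp add: atLeast0LessThan add.commute)
  qed simp
  finally show ?thesis
    by (simp add: sum.swap[of _ "{..<a}"])
qed

text \<open>The quadratic term in \<open>l\<close> is the same in both factors and cancels; the rest
  is linear in \<open>l\<close>, so summing over \<open>l\<close> gives a geometric sum.\<close>

lemma mow_product:
  fixes t k m l d :: nat
  defines "u \<equiv> (k + t) div m" and "v \<equiv> (k + t) mod m"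
  assumes "k < m"
  shows "mow_sequence s m d (l * m + k) * cnj (mow_sequence s m d (l * m + k + t)) =
    unit_root (2 * s * m) (- (int m * int d * (int u)\<^sup>2 + 2 * int v * int u)) *
    unit_root (2 * s * m) (2 * (int k - int v - int m * int d * int u) * int l)"
proof -
  have "(l * m + (k + t)) div m = l + u" "(l * m + (k + t)) mod m = v"
    using assms by (simp_all add: u_def v_def)
  then have "int (mow_exponent m d (l * m + k)) + - int (mow_exponent m d (l * m + k + t))
    = - (int m * int d * (int u)\<^sup>2 + 2 * int v * int u) +
      2 * (int k - int v - int m * int d * int u) * int l"
    using assms by (simp add: mow_exponent_def add.assoc) (simp add: algebra_simps power2_eq_square)
  then show ?thesis
    by (simp add: mow_sequence_def cnj_unit_root flip: unit_root_add)
qed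

text \<open>The divisibility assumption makes \<open>d\<close> a unit modulo \<open>s\<close>, so
  that for shifts \<open>m * q\<close> the sum over \<open>l\<close> survives only if
  \<open>s\<close> divides \<open>q\<close>.\<close>

lemma mow_autocorrelation:
  assumes s: "s > 0" and m: "m > 0" and d: "\<And>x. int s dvd int d * x \<Longrightarrow> int s dvd x"
    and t: "0 < t" "t < s * m\<^sup>2"
  shows "(\<Sum>i<s * m\<^sup>2. mow_sequence s m d i * cnj (mow_sequence s m d (i + t))) = 0"
proof -
  define N where "N = 2 * s * m"
  define x where "x k = int k - int ((k + t) mod m) - int m * int d * int ((k + t) div m)" for k
  define C where "C k = unit_root N (- (int m * int d * (int ((k + t) div m))\<^sup>2
                        + 2 * int ((k + t) mod m) * int ((k + t) div m)))" for k
  have N: "N > 0" "int N = 2 * (int s * int m)"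
    using s m by (simp_all add: N_def)
  have "(\<Sum>i<s * m\<^sup>2. mow_sequence s m d i * cnj (mow_sequence s m d (i + t))) =
      (\<Sum>k<m. \<Sum>l<s * m. mow_sequence s m d (l * m + k) * cnj (mow_sequence s m d (l * m + k + t)))"
    using sum_lessThan_mult_nat[of _ "s * m" m] by (simp add: power2_eq_square mult.assoc)
  also have "\<dots> = (\<Sum>k<m. C k * (\<Sum>l<s * m. unit_root N (2 * x k * int l)))"
    by (intro sum.cong) (simp_all add: mow_product C_def x_def N_def sum_distrib_left)
  finally have sum_eq: "(\<Sum>i<s * m\<^sup>2. mow_sequence s m d i * cnj (mow_sequence s m d (i + t))) =
      (\<Sum>k<m. C k * (\<Sum>l<s * m. unit_root N (2 * x k * int l)))" .
  \<comment> \<open>\<open>N\<close> always divides \<open>2 * x k * (s * m)\<close>, so only the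
    ratio has to differ from 1.\<close>
  have inner: "(\<Sum>l<s * m. unit_root N (2 * x k * int l)) = 0" if "\<not> int s * int m dvd x k" for k
    using that N by (intro sum_unit_root_eq_0) auto
  show ?thesis
  proof (cases "m dvd t")
    case False
    have "\<not> int s * int m dvd x k" if "k < m" for k
    proof
      assume "int s * int m dvd x k"
      \<comment> \<open>Modulo \<open>m\<close> only \<open>k - (k + t) mod m\<close> is left of
        \<open>x k\<close>.\<close>
      then have "int m dvd x k"
        by (rule dvd_mult_right)
      then have "int m dvd int k - int ((k + t) mod m)"
        unfolding x_def by (metis dvd_diff_right_iff dvd_triv_left mult.assoc dvd_diffD dvd_diff_left_iff)
      then have "k mod m = (k + t) mod m"
        by (metis mod_eq_dvd_iff mod_mod_trivial of_nat_eq_iff of_nat_mod)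
      then have "m dvd (k + t) - k"
        by (metis le_add1 mod_eq_dvd_iff_nat)
      with False show False
        by simp
    qed
    then show ?thesis
      unfolding sum_eq by (intro sum.neutral) (auto simp: inner)
  next
    case True
    then obtain q where q: "t = m * q" ..
    have qb: "0 < q" "q < s * m"
      using t m by (auto simp: q power2_eq_square mult.left_commute)
    have div: "(k + t) div m = q" "(k + t) mod m = k" if "k < m" for k
      using that by (simp_all add: q)
    show ?thesis
    proof (cases "s dvd q")
      case False
      have "\<not> int s * int m dvd x k" if "k < m" for k
      proof
        assume "int s * int m dvd x k"
        then have "int m * int s dvd int m * (int d * int q)"
          using that by (simp add: x_def div mult_ac)
        then have "int s dvd int d * int q"
          using m by simp
        with d False show False
          by (metis int_dvd_int_iff)
      qed
      then show ?thesis
        unfolding sum_eq by (intro sum.neutral) (auto simp: inner)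
    next
      case True
      then obtain r where r: "q = s * r" ..
      \<comment> \<open>Now \<open>x k = - m * d * q\<close> is a multiple of \<open>s * m\<close>,
        so the cancellation must come from \<open>C k\<close>, which is geometric in
        \<open>k\<close>; its ratio is not 1 because \<open>0 < q < s * m\<close>.\<close>
      have "unit_root N (2 * x k * int l) = 1" if "k < m" for k l
        using that N by (simp add: unit_root_eq_1_iff x_def div r)
      then have "(\<Sum>k<m. C k * (\<Sum>l<s * m. unit_root N (2 * x k * int l)))
          = (\<Sum>k<m. C k * of_nat (s * m))"
        by (intro sum.cong) auto
      also have "\<dots> = (\<Sum>k<m. unit_root N (- (int m * int d * (int q)\<^sup>2)) *
          unit_root N ((- 2 * int q) * int k) * of_nat (s * m))"
        by (intro sum.cong) (auto simp: C_def div algebra_simps simp flip: unit_root_add)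
      also have "\<dots> = unit_root N (- (int m * int d * (int q)\<^sup>2)) *
          (\<Sum>k<m. unit_root N ((- 2 * int q) * int k)) * of_nat (s * m)"
        by (simp add: sum_distrib_left sum_distrib_right)
      also have "(\<Sum>k<m. unit_root N ((- 2 * int q) * int k)) = 0"
      proof (rule sum_unit_root_eq_0)
        show "int N dvd (- 2 * int q) * int m"
          by (simp add: N r)
        have "\<not> s * m dvd q"
          using qb by (auto dest: dvd_imp_le)
        then show "\<not> int N dvd - 2 * int q"
          by (simp add: N) (metis int_dvd_int_iff of_nat_mult)
      qed (rule N)
      finally show ?thesis
        by (simp add: sum_eq)
    qed
  qed
qed

lemma mow_sequence_power:
  assumes "s > 0" "m > 0" "2 * s * m dvd h \<or> even (m * d) \<and> s * m dvd h"
  shows "mow_sequence s m d i ^ h = 1"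
proof -
  have "2 * s * m dvd mow_exponent m d i * h"
    using assms(3)
  proof
    assume "even (m * d) \<and> s * m dvd h"
    then have "2 * (s * m) dvd mow_exponent m d i * h"
      by (intro mult_dvd_mono) (auto simp: mow_exponent_def)
    then show ?thesis
      by (simp add: mult.assoc)
  qed simp
  then show ?thesis
    using assms by (simp add: mow_sequence_def unit_root_power unit_root_eq_1_iff
        flip: of_nat_mult)
qed

lemma perfect_mow_sequence:
  assumes sm: "s > 0" "m > 0" and h: "2 * s * m dvd h \<or> (odd s \<or> even m) \<and> s * m dvd h"
  shows "perfect_sequence h (s * m\<^sup>2) (mow_sequence s m (if even s then 1 else 2))"
proof -
  \<comment> \<open>Periodicity needs \<open>d * s\<close> even, and \<open>d\<close> must be a unit
    modulo \<open>s\<close>: 1 serves for even \<open>s\<close>, 2 for odd \<open>s\<close>.\<close>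
  define d :: nat where "d = (if even s then 1 else 2)"
  have "int s dvd x" if "int s dvd int d * x" for x
    using that by (auto simp: d_def coprime_dvd_mult_right_iff split: if_splits)
  moreover have "even (d * s)"
    by (simp add: d_def)
  moreover have "2 * s * m dvd h \<or> even (m * d) \<and> s * m dvd h"
    using h by (auto simp: d_def)
  ultimately have "perfect_sequence h (s * m\<^sup>2) (mow_sequence s m d)"
    using sm unfolding perfect_sequence_def
    by (simp add: mow_sequence_power mow_sequence_mod mow_autocorrelation)
  then show ?thesis
    by (simp add: d_def)
qed

section \<open>Choice of parameters for a given length\<close>

lemma perfect_sequence_exists:
  fixes h n :: nat
  assumes "h > 0" "n > 0" and n: "n dvd (gcd h n)\<^sup>2"
    and two: "(multiplicity 2 n, multiplicity 2 h) \<noteq> (1, 1)"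
  shows "\<exists>a. perfect_sequence h n a"
proof -
  define g where "g = gcd h n"
  have g: "g > 0" "g dvd h"
    using assms by (simp_all add: g_def)
  obtain m where m: "n = g * m"
    using gcd_dvd2[of h n] unfolding g_def by (rule dvdE)
  obtain s where "g\<^sup>2 = n * s"
    using n unfolding g_def by (rule dvdE)
  then have gsm: "g = s * m"
    using g by (simp add: m power2_eq_square mult_ac)
  have nsm: "n = s * m\<^sup>2" and sm: "s > 0" "m > 0"
    using m gsm g by (auto simp: power2_eq_square)
  consider "odd s \<or> even m" | q where "s = 4 * q" | "even s" "\<not> 4 dvd s" "odd m"
    by (auto elim: dvdE)
  then show ?thesis
  proof cases
    case 1
    then show ?thesis
      using perfect_mow_sequence[of s m h] sm g gsm nsm by auto
  next
    case (2 q)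
    have "q * (2 * m) dvd g"
      by (simp add: gsm 2)
    then have "q * (2 * m) dvd h"
      using g(2) by (rule dvd_trans)
    moreover have "n = q * (2 * m)\<^sup>2"
      by (simp add: nsm 2 power2_eq_square)
    ultimately show ?thesis
      using perfect_mow_sequence[of q "2 * m" h] sm 2 by auto
  next
    case 3
    have mult1: "multiplicity 2 x = 1" if "even x" "\<not> 4 dvd x" for x :: nat
      using that by (intro multiplicity_eqI) auto
    have "even h"
      using g gsm 3 by (meson dvd_mult2 dvd_trans)
    have "\<not> 4 dvd n"
    proof
      assume "4 dvd n"
      moreover have "coprime 4 (m\<^sup>2)"
        using 3 coprime_power_left_iff[of 2 2 "m\<^sup>2"] by simp
      ultimately show False
        using 3 by (simp add: nsm coprime_dvd_mult_left_iff)
    qed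
    moreover have "even n"
      using 3 by (simp add: nsm)
    ultimately have "multiplicity 2 n = 1"
      by (intro mult1)
    \<comment> \<open>Were 4 not a divisor of \<open>h\<close>, both valuations would be 1, which
      \<open>two\<close> excludes.\<close>
    with two mult1[OF \<open>even h\<close>] have "4 dvd h"
      by auto
    obtain r where r: "s = 2 * r"
      using 3 by auto
    have "odd (r * m)"
      using 3 r by auto
    then have "coprime 4 (r * m)"
      using coprime_power_left_iff[of 2 2 "r * m"] by simp
    moreover have "r * m dvd h"
      using g gsm r by (metis dvd_mult_right mult.assoc)
    ultimately have "4 * (r * m) dvd h"
      using \<open>4 dvd h\<close> by (metis divides_mult)
    then have "2 * s * m dvd h"
      by (simp add: r mult.assoc)
    then show ?thesis
      using perfect_mow_sequence[of s m h] sm nsm by auto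
  qed
qed

section \<open>Product arrays\<close>

text \<open>The autocorrelation factors over the coordinates, and a nonzero shift has a nonzero
  coordinate, whose factor vanishes.\<close>

lemma perfect_phase_array_prod:
  assumes a: "\<And>j. j \<in> {1..k} \<Longrightarrow> perfect_sequence h (n j) (a j)"
  shows "perfect_phase_array h k n (\<lambda>i. \<Prod>j\<in>{1..k}. a j (i j))"
  unfolding perfect_phase_array_def
proof (intro conjI ballI impI)
  fix i
  show "(\<Prod>j\<in>{1..k}. a j (i j)) ^ h = 1"
    using a by (simp add: prod_power_distrib perfect_sequence_def)
next
  fix s assume s: "s \<in> array_index k n" "\<exists>j\<in>{1..k}. s j \<noteq> 0"
  then obtain j where j: "j \<in> {1..k}" "0 < s j" "s j < n j"
    by (fastforce simp: array_index_def PiE_iff)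
  have "(\<Sum>i\<in>array_index k n. (\<Prod>j\<in>{1..k}. a j (i j)) *
          cnj (\<Prod>j\<in>{1..k}. a j (shift_index k n i s j))) =
        (\<Sum>i\<in>array_index k n. \<Prod>j\<in>{1..k}. a j (i j) * cnj (a j ((i j + s j) mod n j)))"
    by (simp add: shift_index_def prod.distrib)
  also have "\<dots> = (\<Prod>j\<in>{1..k}. \<Sum>i<n j. a j i * cnj (a j ((i + s j) mod n j)))"
    unfolding array_index_def by (rule prod_sum_PiE[symmetric]) auto
  also have "\<dots> = 0"
    using a[OF j(1)] j by (intro prod_zero) (auto simp: perfect_sequence_def intro!: bexI[of _ j])
  finally show "(\<Sum>i\<in>array_index k n. (\<Prod>j\<in>{1..k}. a j (i j)) *
          cnj (\<Prod>j\<in>{1..k}. a j (shift_index k n i s j))) = 0" .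
qed

theorem theorem4p4:
  fixes k h :: nat and n :: "nat \<Rightarrow> nat"
  assumes "k > 0" and "h > 0"
    and "\<And>i::nat. i \<in> {1..k} \<Longrightarrow> n i > 0"
    and "\<And>i::nat. i \<in> {1..k} \<Longrightarrow> n i dvd (gcd h (n i))\<^sup>2"
    and "\<And>i::nat. i \<in> {1..k} \<Longrightarrow> (multiplicity (2::nat) (n i), multiplicity (2::nat) h) \<noteq> (1, 1)"
  shows "\<exists>A :: (nat \<Rightarrow> nat) \<Rightarrow> complex. perfect_phase_array h k n A"
proof -
  have "\<forall>j\<in>{1..k}. \<exists>a. perfect_sequence h (n j) a"
    using assms(2-5) by (intro ballI perfect_sequence_exists)
  then obtain a where "\<forall>j\<in>{1..k}. perfect_sequence h (n j) (a j)"
    by metis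
  then show ?thesis
    by (intro exI[of _ "\<lambda>i. \<Prod>j\<in>{1..k}. a j (i j)"] perfect_phase_array_prod) blast
qed

end
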